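(* Let $K\ge 1$, let $A_j \in \mathbb{R}^{m\times n_j}$ for $j=1,\dots,K$, and let $$M = \begin{bmatrix} A_1 & A_2 & \cdots & A_K\end{bmatrix} \in \mathbb{R}^{m\times(n_1+\cdots+n_K)}$$ be their horizontal concatenation. For an integer $r$ let $$\mathcal{E}_r^2(M) := \min_{\operatorname{rank}(X)\le r}\|M-X\|_F^2 = \sum_{i>r}\sigma_i^2(M)$$ be the squared optimal rank-$r$ approximation error of $M$ in the Frobenius norm. Then, for every $r\ge 1$, $$\mathcal{E}_r^2(M) \;\le\; \sum_{j=1}^K\|A_j\|_F^2 \;-\; \max_{1\le j\le K}\;\sum_{i\le r}\sigma_i^2(A_j).$$ In particular, if $r\ge \max_{1\le j\le K}\operatorname{rank}(A_j)$, then $$\mathcal{E}_r^2(M)\;\le\;\sum_{j=1}^K\|A_j\|_F^2 \;-\; \max_{1\le j\le K}\|A_j\|_F^2 .$$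
   Context: For a real matrix $X$, $\sigma_1(X)\ge\sigma_2(X)\ge\cdots\ge 0$ denote its singular values in non-increasing order, with the convention that $\sigma_i(X)=0$ for $i$ larger than the smaller dimension of $X$. $\|\cdot\|_F$ is the Frobenius norm. The minimum in the definition of $\mathcal{E}_r$ is over all real matrices $X$ of the same size as $M$ with rank at most $r$. *)

theory Defs
  imports
    "HOL-Library.Multiset"
    "HOL-Computational_Algebra.Polynomial"
    "Jordan_Normal_Form.Char_Poly"
    "Jordan_Normal_Form.DL_Rank"
begin

definition frobenius_norm :: "real mat \<Rightarrow> real" where
  "frobenius_norm A = sqrt (\<Sum>i<dim_row A. \<Sum>j<dim_col A. (A $$ (i, j))\<^sup>2)"

definition mat_rank :: "real mat \<Rightarrow> nat" where
  "mat_rank A = vec_space.rank (dim_row A) A"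

text \<open>The square roots of the eigenvalues of the Gram matrix \<open>A\<^sup>T A\<close>, repeated according to
  algebraic multiplicity, in non-increasing order. The list has \<open>dim_col A\<close> entries.\<close>

definition gram_sqrt_eigenvalues :: "real mat \<Rightarrow> real list" where
  "gram_sqrt_eigenvalues A =
     rev (sorted_list_of_multiset (image_mset sqrt (proots (char_poly (transpose_mat A * A)))))"

text \<open>Singular values are numbered from 1. By convention they are 0 beyond the smaller
  dimension.\<close>

definition singular_value :: "nat \<Rightarrow> real mat \<Rightarrow> real" where
  "singular_value i A =
     (if 1 \<le> i \<and> i \<le> min (dim_row A) (dim_col A) then gram_sqrt_eigenvalues A ! (i - 1) else 0)"

text \<open>\<open>hconcat m K A\<close> is the block row \<open>[A 1, A 2, \<dots>, A K]\<close>, for blocks with \<open>m\<close> rows.\<close>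

definition hconcat :: "nat \<Rightarrow> nat \<Rightarrow> (nat \<Rightarrow> real mat) \<Rightarrow> real mat" where
  "hconcat m K A = mat_of_cols m (concat (map (\<lambda>j. cols (A j)) [1..<Suc K]))"

definition rank_approx_sq_errors :: "nat \<Rightarrow> real mat \<Rightarrow> real set" where
  "rank_approx_sq_errors r M =
     {(frobenius_norm (M - X))\<^sup>2 | X. X \<in> carrier_mat (dim_row M) (dim_col M) \<and> mat_rank X \<le> r}"

text \<open>The set of errors is nonempty and bounded below by 0, so its infimum is its minimum
  as soon as it belongs to the set.\<close>

definition opt_rank_error_sq :: "nat \<Rightarrow> real mat \<Rightarrow> real" where
  "opt_rank_error_sq r M = Inf (rank_approx_sq_errors r M)"

end

theory Submission
  imports Defs "Jordan_Normal_Form.Spectral_Radius" "Jordan_Normal_Form.Schur_Decomposition"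
begin

text \<open>Approximating the block \<open>A j\<close> by its best rank-\<open>r\<close> approximation and all other blocks by zero
  gives a matrix of rank at most \<open>r\<close>, whose error is the sum of all \<open>\<parallel>A k\<parallel>\<^sup>2\<close> minus the \<open>r\<close> largest
  \<open>\<sigma>\<^sub>i\<^sup>2\<close> of \<open>A j\<close>. What remains is the Eckart--Young theorem. Let \<open>u i\<close> be an orthonormal
  eigenbasis of \<open>A\<^sup>T A\<close> with decreasing eigenvalues \<open>d i\<close>. Restricting \<open>A\<close> to the span of the first
  \<open>r\<close> vectors \<open>u i\<close> attains the error \<open>\<Sum>i\<ge>r. d i\<close>. Conversely, if \<open>X\<close> has rank at most \<open>r\<close>, then \<open>A - X\<close>
  agrees with \<open>A\<close> on \<open>n - r\<close> orthonormal vectors \<open>v j\<close> in the kernel of \<open>X\<close>, so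
  \<open>\<parallel>A - X\<parallel>\<^sup>2\<close> is at least \<open>\<Sum>i. d i * w i\<close> with weights \<open>w i = (\<Sum>j. (u i \<bullet> v j)\<^sup>2)\<close> in \<open>[0, 1]\<close> of total
  mass \<open>n - r\<close>; such a sum is smallest when the mass sits on the smallest eigenvalues.\<close>

section \<open>The real spectral theorem\<close>

text \<open>Only the first \<open>k\<close> members of the indexed family are constrained, so
  initial segments and shifts of an orthonormal family are again of this form. For
  \<open>k = n\<close> it is an orthonormal basis.\<close>

definition orthonormal :: "nat \<Rightarrow> nat \<Rightarrow> (nat \<Rightarrow> real vec) \<Rightarrow> bool" where
  "orthonormal n k u \<longleftrightarrow> (\<forall>i<k. u i \<in> carrier_vec n) \<and>
     (\<forall>i<k. \<forall>j<k. u i \<bullet> u j = (if i = j then 1 else 0))"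

lemma orthonormal_carrier: "orthonormal n k u \<Longrightarrow> i < k \<Longrightarrow> u i \<in> carrier_vec n"
  by (simp add: orthonormal_def)

lemma orthonormal_scalar_prod:
  "orthonormal n k u \<Longrightarrow> i < k \<Longrightarrow> j < k \<Longrightarrow> u i \<bullet> u j = (if i = j then 1 else 0)"
  by (simp add: orthonormal_def)

lemma scalar_prod_transpose:
  fixes A :: "'a :: comm_semiring_0 mat"
  assumes "A \<in> carrier_mat m n" "x \<in> carrier_vec n" "y \<in> carrier_vec m"
  shows "(A *\<^sub>v x) \<bullet> y = x \<bullet> (A\<^sup>T *\<^sub>v y)"
  using transpose_vec_mult_scalar[OF assms] assms
  by (metis comm_scalar_prod mult_mat_vec_carrier transpose_carrier_mat)

lemma scalar_prod_symmetric_mat: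
  fixes A :: "'a :: comm_semiring_0 mat"
  assumes "A \<in> carrier_mat n n" "A\<^sup>T = A" "x \<in> carrier_vec n" "y \<in> carrier_vec n"
  shows "(A *\<^sub>v x) \<bullet> y = x \<bullet> (A *\<^sub>v y)"
  using scalar_prod_transpose[OF assms(1,3,4)] assms(2) by simp

lemma scalar_prod_self_eq_0_iff:
  fixes x :: "real vec"
  assumes "x \<in> carrier_vec n"
  shows "x \<bullet> x = 0 \<longleftrightarrow> x = 0\<^sub>v n"
  using conjugate_square_eq_0_vec[OF assms] by simp

lemma scalar_prod_self_ge_0: "(x :: real vec) \<bullet> x \<ge> 0"
  by (simp add: scalar_prod_def sum_nonneg)

text \<open>Packages the family as the columns of a matrix \<open>Q\<close>;
  \<open>Q\<^sup>T\<close> then computes coordinates along the family.\<close>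

lemma orthonormal_mat:
  assumes "orthonormal n k u"
  defines "Q \<equiv> mat_of_cols n (map u [0..<k])"
  shows "Q \<in> carrier_mat n k" "Q\<^sup>T * Q = 1\<^sub>m k" "\<And>i. i < k \<Longrightarrow> col Q i = u i"
    "\<And>i x. i < k \<Longrightarrow> x \<in> carrier_vec n \<Longrightarrow> (Q\<^sup>T *\<^sub>v x) $ i = u i \<bullet> x"
proof -
  show Q: "Q \<in> carrier_mat n k" by (auto simp: Q_def)
  show c: "\<And>i. i < k \<Longrightarrow> col Q i = u i"
    using assms by (auto simp: Q_def orthonormal_def)
  show "Q\<^sup>T * Q = 1\<^sub>m k"
    using Q by (intro eq_matI) (auto simp: c orthonormal_scalar_prod[OF assms(1)])
  show "\<And>i x. i < k \<Longrightarrow> x \<in> carrier_vec n \<Longrightarrow> (Q\<^sup>T *\<^sub>v x) $ i = u i \<bullet> x"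
    using Q by (simp add: c)
qed

text \<open>For a square \<open>Q\<close> the left inverse \<open>Q\<^sup>T\<close> is also a right
  inverse, so \<open>y\<close> can be written as \<open>Q *\<^sub>v (Q\<^sup>T *\<^sub>v y)\<close>
  and \<open>Q\<close> moved across the scalar product.\<close>

lemma parseval:
  assumes u: "orthonormal n n u" and x: "x \<in> carrier_vec n" and y: "y \<in> carrier_vec n"
  shows "x \<bullet> y = (\<Sum>i<n. (u i \<bullet> x) * (u i \<bullet> y))"
proof -
  define Q where "Q = mat_of_cols n (map u [0..<n])"
  note Q = orthonormal_mat[OF u, folded Q_def]
  have "Q * Q\<^sup>T = 1\<^sub>m n"
    by (rule mat_mult_left_right_inverse[OF _ Q(1) Q(2)]) (use Q in auto)
  hence "y = Q *\<^sub>v (Q\<^sup>T *\<^sub>v y)"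
    using Q(1) y by (metis assoc_mult_mat_vec one_mult_mat_vec transpose_carrier_mat)
  hence "x \<bullet> y = x \<bullet> (Q *\<^sub>v (Q\<^sup>T *\<^sub>v y))" by simp
  also have "\<dots> = (Q\<^sup>T *\<^sub>v x) \<bullet> (Q\<^sup>T *\<^sub>v y)"
    using Q(1) x y scalar_prod_transpose[of "Q\<^sup>T" n n x "Q\<^sup>T *\<^sub>v y"] by simp
  also have "\<dots> = (\<Sum>i<n. (u i \<bullet> x) * (u i \<bullet> y))"
    unfolding scalar_prod_def[of "Q\<^sup>T *\<^sub>v x"] using Q x y
    by (intro sum.cong) auto
  finally show ?thesis .
qed

lemma orthonormal_basis_eqI:
  assumes u: "orthonormal n n u" and x: "x \<in> carrier_vec n" and y: "y \<in> carrier_vec n"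
    and eq: "\<And>i. i < n \<Longrightarrow> u i \<bullet> x = u i \<bullet> y"
  shows "x = y"
proof -
  have "z \<bullet> x = z \<bullet> y" if "z \<in> carrier_vec n" for z
    using parseval[OF u that x] parseval[OF u that y] eq by simp
  hence "unit_vec n i \<bullet> x = unit_vec n i \<bullet> y" for i by simp
  thus ?thesis using x y by (intro eq_vecI) (auto, metis scalar_prod_left_unit)
qed

text \<open>Complete \<open>v\<close> to a basis that starts with \<open>v\<close>, apply
  Gram-Schmidt, which keeps the first vector, and normalise, which does not change the unit vector
  \<open>v\<close>.\<close>

lemma orthonormal_extend:
  assumes v: "v \<in> carrier_vec n" "v \<bullet> v = 1"
  obtains w where "orthonormal n n w" "w 0 = v"
proof -
  interpret cof_vec_space n "TYPE(real)" .
  have v0: "v \<noteq> 0\<^sub>v n" using v by auto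
  hence n: "n \<noteq> 0" using v by (metis carrier_vecD eq_vecI index_zero_vec(2) not_less_zero)
  define b where "b = basis_completion v"
  note b = basis_completion[OF v(1) v0, folded b_def]
  define ws where "ws = gram_schmidt n b"
  note ws = gram_schmidt_result[OF b(2,4,5) ws_def]
  have b0: "b = v # tl b" by (simp add: b_def basis_completion_def Let_def)
  have hd: "hd ws = v" unfolding ws_def by (subst b0) (rule gram_schmidt_hd[OF v(1)])
  have len: "length ws = n" using ws b by simp
  have c: "ws ! i \<in> carrier_vec n" if "i < n" for i
    using ws(3) len that by auto
  define w where "w i = (1 / sqrt (ws ! i \<bullet> ws ! i)) \<cdot>\<^sub>v ws ! i" for i
  \<comment> \<open>Being an equivalence, this also says that no \<open>ws ! i\<close> has norm
    zero, so the normalisation is legitimate.\<close>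
  have o: "ws ! i \<bullet> ws ! j = 0 \<longleftrightarrow> i \<noteq> j" if "i < n" "j < n" for i j
    using corthogonalD[OF ws(2), of i j] that len by simp
  have "w i \<bullet> w j = (if i = j then 1 else 0)" if "i < n" "j < n" for i j
  proof -
    have pos: "ws ! i \<bullet> ws ! i \<noteq> 0" using o that by auto
    hence "ws ! i \<bullet> ws ! i > 0"
      using scalar_prod_self_ge_0[of "ws ! i"] by linarith
    moreover have "w i \<bullet> w j = 1 / sqrt (ws ! i \<bullet> ws ! i) * (1 / sqrt (ws ! j \<bullet> ws ! j)) * (ws ! i \<bullet> ws ! j)"
      using c[OF that(1)] c[OF that(2)] by (simp add: w_def)
    ultimately show ?thesis using o[OF that]
      by (auto simp: real_sqrt_mult[symmetric])
  qed
  hence "orthonormal n n w" using c by (auto simp: orthonormal_def w_def)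
  moreover have ws0: "ws ! 0 = v"
    using hd len n by (metis hd_conv_nth length_0_conv)
  have "w 0 = v"
    using ws0 v by (simp add: w_def)
  ultimately show ?thesis using that by blast
qed

text \<open>The complexified matrix has an eigenvector \<open>v\<close>. Symmetry forces its
  eigenvalue to be real, and then the real or the imaginary part of \<open>v\<close> is a nonzero
  real eigenvector.\<close>

lemma real_eigenvector_exists:
  fixes G :: "real mat"
  assumes G: "G \<in> carrier_mat n n" and sym: "G\<^sup>T = G" and n: "n > 0"
  obtains v e where "v \<in> carrier_vec n" "v \<bullet> v = 1" "G *\<^sub>v v = e \<cdot>\<^sub>v v"
proof -
  define C where "C = map_mat complex_of_real G"
  have C: "C \<in> carrier_mat n n" using G by (simp add: C_def)
  obtain l where "eigenvalue C l"
    using spectrum_non_empty[OF C n] by (auto simp: spectrum_def)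
  then obtain v where v: "v \<in> carrier_vec n" "v \<noteq> 0\<^sub>v n" "C *\<^sub>v v = l \<cdot>\<^sub>v v"
    using C by (auto simp: eigenvalue_def eigenvector_def)
  define x y where "x = map_vec Re v" and "y = map_vec Im v"
  have xy: "x \<in> carrier_vec n" "y \<in> carrier_vec n" using v by (auto simp: x_def y_def)
  define a b where "a = Re l" and "b = Im l"
  have ent: "(\<Sum>j<n. complex_of_real (G $$ (i,j)) * v $ j) = l * v $ i" if "i < n" for i
  proof -
    have "(C *\<^sub>v v) $ i = (l \<cdot>\<^sub>v v) $ i" using v by simp
    thus ?thesis using that C G v
      by (simp add: C_def scalar_prod_def atLeast0LessThan)
  qed
  have Gx: "G *\<^sub>v x = a \<cdot>\<^sub>v x - b \<cdot>\<^sub>v y"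
  proof (rule eq_vecI)
    fix i assume "i < dim_vec (a \<cdot>\<^sub>v x - b \<cdot>\<^sub>v y)"
    hence i: "i < n" using xy by simp
    thus "(G *\<^sub>v x) $ i = (a \<cdot>\<^sub>v x - b \<cdot>\<^sub>v y) $ i"
      using arg_cong[OF ent[OF i], of Re] G xy v
      by (simp add: x_def y_def a_def b_def scalar_prod_def atLeast0LessThan)
  qed (use G xy in auto)
  have Gy: "G *\<^sub>v y = b \<cdot>\<^sub>v x + a \<cdot>\<^sub>v y"
  proof (rule eq_vecI)
    fix i assume "i < dim_vec (b \<cdot>\<^sub>v x + a \<cdot>\<^sub>v y)"
    hence i: "i < n" using xy by simp
    thus "(G *\<^sub>v y) $ i = (b \<cdot>\<^sub>v x + a \<cdot>\<^sub>v y) $ i"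
      using arg_cong[OF ent[OF i], of Im] G xy v
      by (simp add: x_def y_def a_def b_def scalar_prod_def atLeast0LessThan)
  qed (use G xy in auto)
  \<comment> \<open>Expanding both sides cancels the terms with \<open>a\<close> and leaves
    \<open>b\<close> times the squared norm of \<open>v\<close>, so \<open>b = 0\<close>.\<close>
  have "(G *\<^sub>v x) \<bullet> y = x \<bullet> (G *\<^sub>v y)"
    by (rule scalar_prod_symmetric_mat[OF G sym xy])
  hence "a * (x \<bullet> y) - b * (y \<bullet> y) = b * (x \<bullet> x) + a * (x \<bullet> y)"
    unfolding Gx Gy using xy
    by (simp add: minus_scalar_prod_distrib[of _ n] scalar_prod_add_distrib[of _ n])
  hence bz: "b * (x \<bullet> x + y \<bullet> y) = 0" by (simp add: algebra_simps)
  have "x \<noteq> 0\<^sub>v n \<or> y \<noteq> 0\<^sub>v n"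
  proof (rule ccontr)
    assume a: "\<not> ?thesis"
    have "v = 0\<^sub>v n"
    proof (rule eq_vecI)
      fix i assume "i < dim_vec (0\<^sub>v n :: complex vec)"
      hence "i < n" by simp
      hence "x $ i = 0" "y $ i = 0" using a by auto
      thus "v $ i = 0\<^sub>v n $ i" using \<open>i < n\<close> v
        by (simp add: x_def y_def complex_eq_iff)
    qed (use v in auto)
    thus False using v by simp
  qed
  then obtain z where z: "z \<in> {x, y}" "z \<noteq> 0\<^sub>v n" by auto
  hence zc: "z \<in> carrier_vec n" using xy by auto
  have pos: "z \<bullet> z > 0"
    using scalar_prod_self_ge_0[of z] scalar_prod_self_eq_0_iff[OF zc] z by linarith
  hence "x \<bullet> x + y \<bullet> y > 0"
    using z(1) scalar_prod_self_ge_0[of x] scalar_prod_self_ge_0[of y] by auto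
  hence "b = 0" using bz by simp
  hence Gz: "G *\<^sub>v z = a \<cdot>\<^sub>v z"
    using z(1) Gx Gy xy by (auto intro!: eq_vecI)
  define c where "c = 1 / sqrt (z \<bullet> z)"
  show ?thesis
  proof (rule that[of "c \<cdot>\<^sub>v z" a])
    show "(c \<cdot>\<^sub>v z) \<bullet> (c \<cdot>\<^sub>v z) = 1"
      using zc pos by (simp add: c_def real_sqrt_mult[symmetric])
    show "G *\<^sub>v (c \<cdot>\<^sub>v z) = a \<cdot>\<^sub>v (c \<cdot>\<^sub>v z)"
      using Gz mult_mat_vec[OF G zc] by (simp add: smult_smult_assoc mult.commute)
  qed (use zc in auto)
qed

text \<open>Induction on the dimension: split off a unit eigenvector \<open>v\<close>, compress
  \<open>G\<close> to the orthogonal complement of \<open>v\<close> as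
  \<open>H = W\<^sup>T * G * W\<close>, diagonalise \<open>H\<close>, and lift its eigenvectors back
  by \<open>W\<close>.\<close>

lemma spectral_theorem:
  fixes G :: "real mat"
  assumes "G \<in> carrier_mat n n" "G\<^sup>T = G"
  shows "\<exists>u d. orthonormal n n u \<and> (\<forall>i<n. G *\<^sub>v u i = d i \<cdot>\<^sub>v u i)"
  using assms
proof (induction n arbitrary: G)
  case 0
  thus ?case by (simp add: orthonormal_def)
next
  case (Suc k)
  note G = Suc.prems(1) and sym = Suc.prems(2)
  obtain v e where v: "v \<in> carrier_vec (Suc k)" "v \<bullet> v = 1" "G *\<^sub>v v = e \<cdot>\<^sub>v v"
    using real_eigenvector_exists[OF G sym] by auto
  obtain w where w: "orthonormal (Suc k) (Suc k) w" "w 0 = v"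
    using orthonormal_extend[OF v(1,2)] .
  have w': "orthonormal (Suc k) k (\<lambda>i. w (Suc i))"
    using w(1) by (simp add: orthonormal_def)
  define W where "W = mat_of_cols (Suc k) (map (\<lambda>i. w (Suc i)) [0..<k])"
  note W = orthonormal_mat[OF w', folded W_def]
  define H where "H = W\<^sup>T * G * W"
  have WG: "W\<^sup>T * G \<in> carrier_mat k (Suc k)" using W(1) G by simp
  have "H\<^sup>T = W\<^sup>T * (G * W)"
    using transpose_mult[OF WG W(1)] transpose_mult[OF _ G, of "W\<^sup>T" k] W(1) sym by (simp add: H_def)
  also have "\<dots> = H"
    using W(1) G by (simp add: H_def assoc_mult_mat[of _ k "Suc k" _ "Suc k"])
  finally have H: "H \<in> carrier_mat k k" "H\<^sup>T = H"
    using WG W(1) by (auto simp: H_def)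
  obtain y d where y: "orthonormal k k y" and Hy: "\<forall>i<k. H *\<^sub>v y i = d i \<cdot>\<^sub>v y i"
    using Suc.IH[OF H] by blast
  have yc: "y i \<in> carrier_vec k" if "i < k" for i using orthonormal_carrier[OF y that] .
  define u where "u i = (case i of 0 \<Rightarrow> v | Suc j \<Rightarrow> W *\<^sub>v y j)" for i
  define f where "f i = (case i of 0 \<Rightarrow> e | Suc j \<Rightarrow> d j)" for i
  have Wc: "W *\<^sub>v x \<in> carrier_vec (Suc k)" if "x \<in> carrier_vec k" for x using W(1) that by auto
  have WTW: "W\<^sup>T *\<^sub>v (W *\<^sub>v x) = x" if "x \<in> carrier_vec k" for x
    using W(1,2) that by (metis assoc_mult_mat_vec one_mult_mat_vec transpose_carrier_mat)
  have vW: "v \<bullet> (W *\<^sub>v x) = 0" if x: "x \<in> carrier_vec k" for x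
  proof -
    have "W\<^sup>T *\<^sub>v v = 0\<^sub>v k"
      using W(1) W(4)[OF _ v(1)] orthonormal_scalar_prod[OF w(1), of "Suc _" 0] w(2)
      by (intro eq_vecI) auto
    moreover have "(W *\<^sub>v x) \<bullet> v = x \<bullet> (W\<^sup>T *\<^sub>v v)" by (rule scalar_prod_transpose[OF W(1) x v(1)])
    ultimately show ?thesis using x comm_scalar_prod[OF v(1) Wc[OF x]] by simp
  qed
  \<comment> \<open>Compared coordinatewise in the basis \<open>w\<close>: along \<open>v\<close>
    both sides vanish, since \<open>G\<close> maps the complement of \<open>v\<close> into itself;
    along the other members this is the eigenvalue equation of \<open>H\<close>.\<close>
  have "G *\<^sub>v (W *\<^sub>v y j) = d j \<cdot>\<^sub>v (W *\<^sub>v y j)" if j: "j < k" for j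
  proof (rule orthonormal_basis_eqI[OF w(1)])
    show c: "G *\<^sub>v (W *\<^sub>v y j) \<in> carrier_vec (Suc k)" "d j \<cdot>\<^sub>v (W *\<^sub>v y j) \<in> carrier_vec (Suc k)"
      using G Wc[OF yc[OF j]] by auto
    fix i assume i: "i < Suc k"
    show "w i \<bullet> (G *\<^sub>v (W *\<^sub>v y j)) = w i \<bullet> (d j \<cdot>\<^sub>v (W *\<^sub>v y j))"
    proof (cases i)
      case 0
      have "v \<bullet> (G *\<^sub>v (W *\<^sub>v y j)) = (e \<cdot>\<^sub>v v) \<bullet> (W *\<^sub>v y j)"
        using scalar_prod_symmetric_mat[OF G sym v(1) Wc[OF yc[OF j]]] v(3) by simp
      thus ?thesis using vW[OF yc[OF j]] v(1) Wc[OF yc[OF j]] by (simp add: 0 w(2))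
    next
      case (Suc l)
      hence l: "l < k" using i by simp
      have "w i \<bullet> (G *\<^sub>v (W *\<^sub>v y j)) = (W\<^sup>T *\<^sub>v (G *\<^sub>v (W *\<^sub>v y j))) $ l"
        using W(4)[OF l c(1)] Suc by simp
      also have "W\<^sup>T *\<^sub>v (G *\<^sub>v (W *\<^sub>v y j)) = H *\<^sub>v y j"
        unfolding H_def assoc_mult_mat_vec[OF WG W(1) yc[OF j]]
        using assoc_mult_mat_vec[OF _ G Wc[OF yc[OF j]], of "W\<^sup>T" k] W(1) by simp
      also have "\<dots> = W\<^sup>T *\<^sub>v (d j \<cdot>\<^sub>v (W *\<^sub>v y j))"
        using Hy j W(1) Wc[OF yc[OF j]] WTW[OF yc[OF j]]
        by (simp add: mult_mat_vec[of _ k "Suc k"])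
      also have "\<dots> $ l = w i \<bullet> (d j \<cdot>\<^sub>v (W *\<^sub>v y j))"
        using W(4)[OF l c(2)] Suc by simp
      finally show ?thesis .
    qed
  qed
  hence ev: "\<forall>i<Suc k. G *\<^sub>v u i = f i \<cdot>\<^sub>v u i"
    using v(3) by (auto simp: u_def f_def split: nat.split)
  have WW: "(W *\<^sub>v y i) \<bullet> (W *\<^sub>v y j) = (if i = j then 1 else 0)" if "i < k" "j < k" for i j
    using scalar_prod_transpose[OF W(1) yc[OF that(1)] Wc[OF yc[OF that(2)]]]
      WTW[OF yc[OF that(2)]] orthonormal_scalar_prod[OF y that] by simp
  have Wv: "(W *\<^sub>v y i) \<bullet> v = 0" if "i < k" for i
    using vW[OF yc[OF that]] comm_scalar_prod[OF v(1) Wc[OF yc[OF that]]] by simp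
  have "orthonormal (Suc k) (Suc k) u"
    using v Wc yc WW Wv vW by (auto simp: orthonormal_def u_def split: nat.split)
  thus ?case using ev by blast
qed

section \<open>Frobenius norm and rank\<close>

lemma scalar_prod_self_sum: "x \<in> carrier_vec n \<Longrightarrow> (x :: real vec) \<bullet> x = (\<Sum>i<n. (x $ i)\<^sup>2)"
  by (auto simp: scalar_prod_def power2_eq_square atLeast0LessThan)

lemma frobenius_norm_sq:
  "A \<in> carrier_mat m n \<Longrightarrow> (frobenius_norm A)\<^sup>2 = (\<Sum>i<m. \<Sum>j<n. (A $$ (i, j))\<^sup>2)"
  by (auto simp: frobenius_norm_def sum_nonneg)

text \<open>Parseval applied to each row of \<open>A\<close>, followed by an exchange of sums. It
  lets the norm be computed in whichever eigenbasis is convenient.\<close>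

lemma frobenius_norm_sq_orthonormal:
  assumes A: "A \<in> carrier_mat m n" and u: "orthonormal n n u"
  shows "(frobenius_norm A)\<^sup>2 = (\<Sum>j<n. (A *\<^sub>v u j) \<bullet> (A *\<^sub>v u j))"
proof -
  have "(frobenius_norm A)\<^sup>2 = (\<Sum>i<m. row A i \<bullet> row A i)"
    unfolding frobenius_norm_sq[OF A] using A
    by (intro sum.cong) (auto simp: scalar_prod_self_sum[of _ n])
  also have "\<dots> = (\<Sum>i<m. \<Sum>j<n. ((A *\<^sub>v u j) $ i)\<^sup>2)"
  proof (intro sum.cong refl)
    fix i assume "i \<in> {..<m}"
    hence r: "row A i \<in> carrier_vec n" and i: "i < dim_row A" using A by auto
    show "row A i \<bullet> row A i = (\<Sum>j<n. ((A *\<^sub>v u j) $ i)\<^sup>2)"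
      unfolding parseval[OF u r r] using i comm_scalar_prod[OF r orthonormal_carrier[OF u]]
      by (intro sum.cong) (auto simp: power2_eq_square)
  qed
  also have "\<dots> = (\<Sum>j<n. \<Sum>i<m. ((A *\<^sub>v u j) $ i)\<^sup>2)" by (rule sum.swap)
  also have "\<dots> = (\<Sum>j<n. (A *\<^sub>v u j) \<bullet> (A *\<^sub>v u j))"
    using A orthonormal_carrier[OF u] by (intro sum.cong refl scalar_prod_self_sum[symmetric]) auto
  finally show ?thesis .
qed

lemma sorted_spectral_theorem:
  fixes G :: "real mat"
  assumes "G \<in> carrier_mat n n" "G\<^sup>T = G"
  obtains u d where "orthonormal n n u" "\<And>i. i < n \<Longrightarrow> G *\<^sub>v u i = d i \<cdot>\<^sub>v u i"
    "\<And>i j. i \<le> j \<Longrightarrow> j < n \<Longrightarrow> (d j :: real) \<le> d i"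
proof -
  obtain u d where u: "orthonormal n n u" and ev: "\<And>i. i < n \<Longrightarrow> G *\<^sub>v u i = d i \<cdot>\<^sub>v u i"
    using spectral_theorem[OF assms] by blast
  \<comment> \<open>Sorting the indices by \<open>- d i\<close> puts the eigenvalues in
    non-increasing order.\<close>
  define es where "es = sort_key (\<lambda>i. - d i) [0..<n]"
  have len: "length es = n" and dist: "distinct es" and set: "set es = {0..<n}"
    by (auto simp: es_def)
  have p: "es ! i < n" if "i < n" for i
    using that len set nth_mem[of i es] by auto
  show ?thesis
  proof (rule that[of "\<lambda>i. u (es ! i)" "\<lambda>i. d (es ! i)"])
    show "orthonormal n n (\<lambda>i. u (es ! i))"
      using u p dist len by (auto simp: orthonormal_def nth_eq_iff_index_eq)
    show "G *\<^sub>v u (es ! i) = d (es ! i) \<cdot>\<^sub>v u (es ! i)" if "i < n" for i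
      using ev p that by simp
    have "sorted (map (\<lambda>i. - d i) es)" unfolding es_def by (rule sorted_sort_key)
    thus "d (es ! j) \<le> d (es ! i)" if "i \<le> j" "j < n" for i j
      using sorted_nth_mono[of "map (\<lambda>i. - d i) es" i j] that len by simp
  qed
qed

text \<open>Compare \<open>w\<close> with the indicator \<open>t\<close> of the tail. Both have the
  same total, so replacing \<open>d i\<close> by \<open>d i - d r\<close> does not change the
  difference of the two weighted sums. Then the factors \<open>d i - d r\<close> and
  \<open>w i - t i\<close> never have opposite signs: both are \<le> 0 from \<open>r\<close> on and
  both are \<ge> 0 before.\<close>

lemma sum_tail_le_weighted_sum:
  fixes d w :: "nat \<Rightarrow> real"
  assumes dec: "\<And>i j. i \<le> j \<Longrightarrow> j < n \<Longrightarrow> d j \<le> d i"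
    and w: "\<And>i. i < n \<Longrightarrow> 0 \<le> w i \<and> w i \<le> 1"
    and total: "(\<Sum>i<n. w i) = real (n - r)"
    and r: "r < n"
  shows "(\<Sum>i=r..<n. d i) \<le> (\<Sum>i<n. d i * w i)"
proof -
  define t where "t i = (if r \<le> i then 1 else 0 :: real)" for i
  have tail: "{..<n} \<inter> {i. r \<le> i} = {r..<n}" by auto
  have t1: "(\<Sum>i<n. t i) = real (n - r)" and t2: "(\<Sum>i<n. d i * t i) = (\<Sum>i=r..<n. d i)"
    by (simp_all add: t_def if_distrib[of "(*) _"] sum.If_cases tail cong: if_cong)
  have "0 \<le> (\<Sum>i<n. (d i - d r) * (w i - t i))"
  proof (intro sum_nonneg)
    fix i assume "i \<in> {..<n}"
    hence i: "i < n" by simp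
    show "0 \<le> (d i - d r) * (w i - t i)"
    proof (cases "r \<le> i")
      case True
      thus ?thesis using dec[of r i] w[OF i] i by (auto simp: t_def mult_nonpos_nonpos)
    next
      case False
      thus ?thesis using dec[of i r] w[OF i] r by (auto simp: t_def)
    qed
  qed
  also have "\<dots> = (\<Sum>i<n. d i * w i) - (\<Sum>i<n. d i * t i) - d r * ((\<Sum>i<n. w i) - (\<Sum>i<n. t i))"
    by (simp add: algebra_simps sum.distrib sum_subtractf sum_distrib_left)
  finally show ?thesis by (simp add: total t1 t2)
qed

section \<open>Rank bounds from spans of columns\<close>

context vec_space
begin

lemma card_indpt_le_dim_span:
  assumes S: "finite S" "S \<subseteq> carrier_vec n" and U: "lin_indpt U" "U \<subseteq> span S"
  shows "card U \<le> vectorspace.dim class_ring (span_vs S)"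
proof -
  have sub: "submodule class_ring (span S) V" using S by (simp add: span_is_submodule)
  interpret W: vectorspace class_ring "span_vs S"
    using S by (intro subspace_is_vs span_is_subspace) simp
  show ?thesis
  proof (rule W.li_le_dim)
    show "W.fin_dim" using fin_dim_span[of S] S by simp
    show "U \<subseteq> carrier (span_vs S)" using U by simp
    show "W.lin_indpt U" using span_li_not_depend(2)[OF U(2) sub] U(1) by simp
  qed
qed

text \<open>The rank is the size of a maximal independent set of columns, and that set lies in
  \<open>span S\<close>.\<close>

lemma rank_le_dim_span:
  assumes A: "A \<in> carrier_mat n nc" and S: "finite S" "S \<subseteq> carrier_vec n"
    and cols: "set (cols A) \<subseteq> span S"
  shows "rank A \<le> vectorspace.dim class_ring (span_vs S)"
proof -
  obtain U where U: "maximal U (\<lambda>T. T \<subseteq> set (cols A) \<and> lin_indpt T)"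
    using maximal_exists_superset[of "set (cols A)" "\<lambda>T. T \<subseteq> set (cols A) \<and> lin_indpt T" "{}"]
    by (auto simp: lin_dep_def)
  hence "lin_indpt U" "U \<subseteq> span S" using cols by (auto simp: maximal_def)
  from card_indpt_le_dim_span[OF S this] show ?thesis using rank_card_indpt[OF A U] by simp
qed

lemma mult_mat_vec_in_span_cols:
  assumes A: "A \<in> carrier_mat n nc" and x: "x \<in> carrier_vec nc"
  shows "A *\<^sub>v x \<in> span (set (cols A))"
proof -
  have "mat_of_cols n (cols A) = A" using A mat_of_cols_cols[of A] by simp
  thus ?thesis
    using mat_of_cols_mult_as_finsum[of x "cols A"] A x
    by (intro in_spanI[of _ _ "set (cols A)"]) auto
qed

end

text \<open>Every column of \<open>B * C\<close> is a combination of the \<open>k\<close> columns of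
  \<open>B\<close>.\<close>

lemma mat_rank_mult_le:
  assumes B: "B \<in> carrier_mat m k" and C: "C \<in> carrier_mat k n"
  shows "mat_rank (B * C) \<le> k"
proof -
  interpret vec_space "TYPE(real)" m .
  have BC: "B * C \<in> carrier_mat m n" using B C by simp
  have "set (cols (B * C)) \<subseteq> span (set (cols B))"
  proof
    fix x assume "x \<in> set (cols (B * C))"
    then obtain j where "j < n" "x = col (B * C) j"
      using BC by (metis carrier_matD(2) cols_length cols_nth in_set_conv_nth)
    hence "x = B *\<^sub>v col C j" using B C by auto
    thus "x \<in> span (set (cols B))"
      using mult_mat_vec_in_span_cols[OF B, of "col C j"] C \<open>j < n\<close> by auto
  qed
  hence "rank (B * C) \<le> rank B"
    unfolding rank_def[of B] using B cols_dim[of B] by (intro rank_le_dim_span[OF BC]) auto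
  also have "\<dots> \<le> k" by (rule rank_le_nc[OF B])
  finally show ?thesis using B by (simp add: mat_rank_def)
qed

lemma mat_rank_le_dim_row:
  assumes A: "A \<in> carrier_mat m n"
  shows "mat_rank A \<le> m"
  using mat_rank_mult_le[OF one_carrier_mat A] unfolding left_mult_one_mat[OF A] .

text \<open>Nonzero pairwise orthogonal vectors are independent, and these lie in the column space
  of \<open>A\<close>. It serves to show that Gram eigenvalues beyond the rank vanish.\<close>

lemma card_orthogonal_image_le_mat_rank:
  assumes A: "A \<in> carrier_mat m n" and x: "\<And>i. i < k \<Longrightarrow> x i \<in> carrier_vec n"
    and ne: "\<And>i. i < k \<Longrightarrow> (A *\<^sub>v x i) \<bullet> (A *\<^sub>v x i) \<noteq> 0"
    and orth: "\<And>i j. i < k \<Longrightarrow> j < k \<Longrightarrow> i \<noteq> j \<Longrightarrow> (A *\<^sub>v x i) \<bullet> (A *\<^sub>v x j) = 0"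
  shows "k \<le> mat_rank A"
proof -
  interpret vec_space "TYPE(real)" m .
  define Y where "Y = mat_of_cols m (map (\<lambda>i. A *\<^sub>v x i) [0..<k])"
  have Y: "Y \<in> carrier_mat m k" by (auto simp: Y_def)
  have Ax: "A *\<^sub>v x i \<in> carrier_vec m" if "i < k" for i using A x that by auto
  have cols: "cols Y = map (\<lambda>i. A *\<^sub>v x i) [0..<k]"
    unfolding Y_def using Ax by (intro cols_mat_of_cols) auto
  \<comment> \<open>Independence is a property of the set of columns, which has \<open>k\<close>
    elements only if the columns are distinct.\<close>
  have inj: "inj_on (\<lambda>i. A *\<^sub>v x i) {0..<k}"
  proof (rule inj_onI)
    fix i j assume "i \<in> {0..<k}" "j \<in> {0..<k}" "A *\<^sub>v x i = A *\<^sub>v x j"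
    thus "i = j" using ne[of i] orth[of i j] by (cases "i = j") auto
  qed
  hence dist: "distinct (cols Y)" by (simp add: cols distinct_map)
  have indpt: "lin_indpt (set (cols Y))"
  proof
    assume "lin_dep (set (cols Y))"
    from lin_depE[OF Y this dist] obtain v where v: "v \<in> carrier_vec k" "v \<noteq> 0\<^sub>v k" "Y *\<^sub>v v = 0\<^sub>v m"
      by blast
    have "v $ i = 0" if i: "i < k" for i
    proof -
      \<comment> \<open>The Gram matrix of \<open>Y\<close> is diagonal with nonzero diagonal, so
        \<open>Y *\<^sub>v v = 0\<^sub>v m\<close> forces \<open>v\<close> to vanish.\<close>
      have gram: "(Y\<^sup>T * Y) $$ (i, j) = (if j = i then (A *\<^sub>v x i) \<bullet> (A *\<^sub>v x i) else 0)" if "j < k" for j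
        using Y i that Ax orth[OF i that] by (auto simp: Y_def)
      have YTY: "Y\<^sup>T * Y \<in> carrier_mat k k" using Y by simp
      have "0 = (Y\<^sup>T *\<^sub>v (Y *\<^sub>v v)) $ i" using v(3) Y i by simp
      also have "Y\<^sup>T *\<^sub>v (Y *\<^sub>v v) = (Y\<^sup>T * Y) *\<^sub>v v"
        using Y v(1) by (intro assoc_mult_mat_vec[symmetric]) auto
      also have "\<dots> $ i = (\<Sum>j<k. (Y\<^sup>T * Y) $$ (i, j) * v $ j)"
        using YTY v(1) i by (auto simp: scalar_prod_def atLeast0LessThan intro!: sum.cong)
      also have "\<dots> = (\<Sum>j<k. if j = i then (A *\<^sub>v x i) \<bullet> (A *\<^sub>v x i) * v $ i else 0)"
        using gram by (intro sum.cong) auto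
      also have "\<dots> = (A *\<^sub>v x i) \<bullet> (A *\<^sub>v x i) * v $ i" using i by simp
      finally show ?thesis using ne[OF i] by simp
    qed
    hence "v = 0\<^sub>v k" using v(1) by (intro eq_vecI) auto
    thus False using v(2) by simp
  qed
  have "card (set (cols Y)) \<le> rank A"
    unfolding rank_def
  proof (rule card_indpt_le_dim_span[OF _ _ indpt])
    show "set (cols A) \<subseteq> carrier_vec m" using A cols_dim[of A] by auto
    show "set (cols Y) \<subseteq> span (set (cols A))"
      using mult_mat_vec_in_span_cols[OF A x] by (auto simp: cols)
  qed simp
  moreover have "card (set (cols Y)) = k" using distinct_card[OF dist] Y by simp
  ultimately show ?thesis using A by (simp add: mat_rank_def)
qed

section \<open>The Eckart--Young theorem\<close>

text \<open>The right-hand half of a singular value decomposition: the \<open>u i\<close> are right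
  singular vectors and the \<open>d i\<close> squared singular values, counted from 0. Left singular
  vectors occur only implicitly, as directions of the images \<open>A *\<^sub>v u i\<close>.\<close>

locale gram_eigenbasis =
  fixes A :: "real mat" and m n :: nat and u :: "nat \<Rightarrow> real vec" and d :: "nat \<Rightarrow> real"
  assumes A: "A \<in> carrier_mat m n"
    and orthonormal: "orthonormal n n u"
    and eigen: "\<And>i. i < n \<Longrightarrow> (A\<^sup>T * A) *\<^sub>v u i = d i \<cdot>\<^sub>v u i"
    and decreasing: "\<And>i j. i \<le> j \<Longrightarrow> j < n \<Longrightarrow> d j \<le> d i"

lemma gram_eigenbasis_exists:
  assumes A: "A \<in> carrier_mat m n"
  obtains u d where "gram_eigenbasis A m n u d"
proof -
  have G: "A\<^sup>T * A \<in> carrier_mat n n" "(A\<^sup>T * A)\<^sup>T = A\<^sup>T * A"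
    using A transpose_mult[of "A\<^sup>T" n m A n] by auto
  obtain u d where "orthonormal n n u" "\<And>i. i < n \<Longrightarrow> (A\<^sup>T * A) *\<^sub>v u i = d i \<cdot>\<^sub>v u i"
    "\<And>i j. i \<le> j \<Longrightarrow> j < n \<Longrightarrow> (d j :: real) \<le> d i"
    using sorted_spectral_theorem[OF G] by metis
  hence "gram_eigenbasis A m n u d" using A by unfold_locales auto
  thus ?thesis using that by blast
qed

lemma sort_eq_rev: "sorted (rev xs) \<Longrightarrow> sort xs = rev xs"
  by (metis mset_rev properties_for_sort)

section \<open>Singular values and eigenvalues of the Gram matrix\<close>

context gram_eigenbasis
begin

lemma u_carrier: "i < n \<Longrightarrow> u i \<in> carrier_vec n"
  using orthonormal_carrier[OF orthonormal] .

lemma image_carrier: "x \<in> carrier_vec n \<Longrightarrow> A *\<^sub>v x \<in> carrier_vec m"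
  using A by auto

text \<open>Moving \<open>A\<close> across the product produces the Gram matrix applied to its
  eigenvector \<open>u i\<close>. Hence the images of the \<open>u i\<close> are orthogonal with
  squared norms \<open>d i\<close>.\<close>

lemma image_scalar_prod:
  assumes i: "i < n" and x: "x \<in> carrier_vec n"
  shows "(A *\<^sub>v x) \<bullet> (A *\<^sub>v u i) = d i * (x \<bullet> u i)"
proof -
  have "A\<^sup>T *\<^sub>v (A *\<^sub>v u i) = (A\<^sup>T * A) *\<^sub>v u i"
    using A u_carrier[OF i] by (intro assoc_mult_mat_vec[symmetric]) auto
  thus ?thesis
    using scalar_prod_transpose[OF A x image_carrier[OF u_carrier[OF i]]] eigen[OF i] x u_carrier[OF i]
    by simp
qed

lemma image_norm: "i < n \<Longrightarrow> (A *\<^sub>v u i) \<bullet> (A *\<^sub>v u i) = d i"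
  using image_scalar_prod[OF _ u_carrier] orthonormal_scalar_prod[OF orthonormal] by simp

lemma image_orthogonal: "i < n \<Longrightarrow> j < n \<Longrightarrow> i \<noteq> j \<Longrightarrow> (A *\<^sub>v u i) \<bullet> (A *\<^sub>v u j) = 0"
  using image_scalar_prod[OF _ u_carrier] orthonormal_scalar_prod[OF orthonormal] by simp

lemma eigenvalue_nonneg: "i < n \<Longrightarrow> d i \<ge> 0"
  using image_norm scalar_prod_self_ge_0 by metis

lemma image_norm_sum:
  assumes x: "x \<in> carrier_vec n"
  shows "(A *\<^sub>v x) \<bullet> (A *\<^sub>v x) = (\<Sum>i<n. d i * (u i \<bullet> x)\<^sup>2)"
proof -
  have c: "A\<^sup>T *\<^sub>v (A *\<^sub>v x) \<in> carrier_vec n" using A x by auto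
  have "(A *\<^sub>v x) \<bullet> (A *\<^sub>v x) = x \<bullet> (A\<^sup>T *\<^sub>v (A *\<^sub>v x))"
    by (rule scalar_prod_transpose[OF A x image_carrier[OF x]])
  also have "\<dots> = (\<Sum>i<n. (u i \<bullet> x) * (u i \<bullet> (A\<^sup>T *\<^sub>v (A *\<^sub>v x))))"
    by (rule parseval[OF orthonormal x c])
  also have "\<dots> = (\<Sum>i<n. d i * (u i \<bullet> x)\<^sup>2)"
  proof (intro sum.cong refl)
    fix i assume "i \<in> {..<n}"
    hence i: "i < n" by simp
    have "u i \<bullet> (A\<^sup>T *\<^sub>v (A *\<^sub>v x)) = (A *\<^sub>v u i) \<bullet> (A *\<^sub>v x)"
      using scalar_prod_transpose[OF A u_carrier[OF i] image_carrier[OF x]] by simp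
    also have "\<dots> = (A *\<^sub>v x) \<bullet> (A *\<^sub>v u i)"
      by (rule comm_scalar_prod[OF image_carrier[OF u_carrier[OF i]] image_carrier[OF x]])
    also have "\<dots> = d i * (u i \<bullet> x)"
      using image_scalar_prod[OF i x] comm_scalar_prod[OF x u_carrier[OF i]] by simp
    finally show "(u i \<bullet> x) * (u i \<bullet> (A\<^sup>T *\<^sub>v (A *\<^sub>v x))) = d i * (u i \<bullet> x)\<^sup>2"
      by (simp add: power2_eq_square)
  qed
  finally show ?thesis .
qed

text \<open>The eigenbasis makes the Gram matrix similar to the diagonal matrix \<open>D\<close>.
  This links the eigenbasis to the roots, with multiplicity, by which singular values are
  defined.\<close>

lemma char_poly_gram: "char_poly (A\<^sup>T * A) = (\<Prod>a\<leftarrow>map d [0..<n]. [:- a, 1:])"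
proof -
  define Q where "Q = mat_of_cols n (map u [0..<n])"
  note Q = orthonormal_mat[OF orthonormal, folded Q_def]
  have QQT: "Q * Q\<^sup>T = 1\<^sub>m n"
    by (rule mat_mult_left_right_inverse[OF _ Q(1) Q(2)]) (use Q in auto)
  define D where "D = mat n n (\<lambda>(i, j). if i = j then d i else 0)"
  have D: "D \<in> carrier_mat n n" by (simp add: D_def)
  have G: "A\<^sup>T * A \<in> carrier_mat n n" using A by simp
  have "(A\<^sup>T * A) * Q = Q * D"
  proof (rule eq_matI)
    fix i j assume "i < dim_row (Q * D)" "j < dim_col (Q * D)"
    hence ij: "i < n" "j < n" using Q(1) D by auto
    have "(H * Q) $$ (i, j) = (H *\<^sub>v u j) $ i" if "H \<in> carrier_mat n n" for H
      using ij that Q(1) Q(3) by simp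
    from this[OF G] have "((A\<^sup>T * A) * Q) $$ (i, j) = ((A\<^sup>T * A) *\<^sub>v u j) $ i" .
    also have "\<dots> = d j * u j $ i" using ij eigen u_carrier[OF ij(2)] by simp
    also have "u j $ i = Q $$ (i, j)" using Q(1) Q(3)[OF ij(2)] ij by (metis carrier_matD index_col)
    also have "d j * \<dots> = (\<Sum>k<n. Q $$ (i, k) * (if k = j then d k else 0))"
      using ij by (simp add: if_distrib[of "(*) _"] cong: if_cong)
    also have "\<dots> = (Q * D) $$ (i, j)"
      using ij Q(1) D by (auto simp: scalar_prod_def atLeast0LessThan D_def intro!: sum.cong)
    finally show "((A\<^sup>T * A) * Q) $$ (i, j) = (Q * D) $$ (i, j)" .
  qed (use G Q(1) D in auto)
  hence "Q * D * Q\<^sup>T = (A\<^sup>T * A) * Q * Q\<^sup>T" by simp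
  also have "\<dots> = A\<^sup>T * A"
    using assoc_mult_mat[OF G Q(1), of "Q\<^sup>T" n] Q(1) QQT right_mult_one_mat[OF G] by simp
  finally have diag: "A\<^sup>T * A = Q * D * Q\<^sup>T" ..
  have "similar_mat (A\<^sup>T * A) D"
    by (rule similar_matI[OF _ QQT Q(2) diag]) (use G D Q(1) in simp)
  hence "char_poly (A\<^sup>T * A) = char_poly D" by (rule char_poly_similar)
  also have "\<dots> = (\<Prod>a\<leftarrow>diag_mat D. [:- a, 1:])"
    by (rule char_poly_upper_triangular[OF D]) (auto simp: D_def)
  also have "diag_mat D = map d [0..<n]" by (auto simp: D_def diag_mat_def)
  finally show ?thesis .
qed

text \<open>The roots of the factored polynomial are the \<open>d i\<close>. Since
  \<open>sqrt\<close> is monotone, the list of their roots is already non-increasing, so sorting it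
  upwards and reversing gives it back.\<close>

lemma gram_sqrt_eigenvalues_eq: "gram_sqrt_eigenvalues A = map (\<lambda>i. sqrt (d i)) [0..<n]"
proof -
  define xs where "xs = map (\<lambda>i. sqrt (d i)) [0..<n]"
  have nz: "0 \<notin> set (map (\<lambda>a. [:- a, 1:]) (map d [0..<n]))" by auto
  have "proots (char_poly (A\<^sup>T * A)) = (\<Sum>p\<leftarrow>map (\<lambda>a. [:- a, 1:]) (map d [0..<n]). proots p)"
    using proots_prod_list[OF nz] by (simp only: char_poly_gram map_ident)
  also have "\<dots> = (\<Sum>a\<leftarrow>map d [0..<n]. {#a#})" by (simp add: o_def)
  also have "\<dots> = mset (map d [0..<n])"
    by (induction n) auto
  finally have "image_mset sqrt (proots (char_poly (A\<^sup>T * A))) = mset xs"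
    by (simp add: xs_def multiset.map_comp o_def)
  hence "gram_sqrt_eigenvalues A = rev (sort xs)"
    by (simp add: gram_sqrt_eigenvalues_def)
  moreover have "sorted (rev xs)"
    unfolding sorted_rev_iff_nth_mono using decreasing by (auto simp: xs_def)
  ultimately show ?thesis by (simp add: sort_eq_rev xs_def)
qed

text \<open>The shift by \<open>Suc\<close> is there because singular values are numbered from 1 and
  the \<open>d i\<close> from 0; nonnegativity of \<open>d i\<close> lets the square undo
  \<open>sqrt\<close>.\<close>

lemma singular_value_sq:
  assumes "i < min m n"
  shows "(singular_value (Suc i) A)\<^sup>2 = d i"
  using assms A eigenvalue_nonneg[of i]
  by (simp add: singular_value_def gram_sqrt_eigenvalues_eq)

text \<open>If \<open>d i\<close> were nonzero, so would be all \<open>d j\<close> with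
  \<open>j \<le> i\<close>, and the images of \<open>u 0\<close> to \<open>u i\<close> would be
  \<open>Suc i\<close> nonzero orthogonal vectors in the column space.\<close>

lemma eigenvalue_eq_0:
  assumes i: "mat_rank A \<le> i" "i < n"
  shows "d i = 0"
proof (rule ccontr)
  assume ne: "d i \<noteq> 0"
  have pos: "d j \<noteq> 0" if "j \<le> i" for j
    using ne eigenvalue_nonneg[OF i(2)] decreasing[OF that i(2)] by linarith
  have "Suc i \<le> mat_rank A"
    using i pos u_carrier image_norm image_orthogonal
    by (intro card_orthogonal_image_le_mat_rank[OF A, of _ u]) auto
  thus False using i by simp
qed

lemma eigenvalue_eq_0': "m \<le> i \<Longrightarrow> i < n \<Longrightarrow> d i = 0"
  using eigenvalue_eq_0 mat_rank_le_dim_row[OF A] by auto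

lemma frobenius_norm_sq_eq: "(frobenius_norm A)\<^sup>2 = (\<Sum>i<n. d i)"
  unfolding frobenius_norm_sq_orthonormal[OF A orthonormal] by (simp add: image_norm)

text \<open>Singular values stop at \<open>min m n\<close> whereas there are \<open>n\<close>
  eigenvalues; the surplus ones have index at least \<open>m\<close> and vanish.\<close>

lemma sum_singular_value_tail:
  "(\<Sum>i\<in>{r<..min m n}. (singular_value i A)\<^sup>2) = (\<Sum>i=r..<n. d i)"
proof -
  have "(\<Sum>i\<in>{r<..min m n}. (singular_value i A)\<^sup>2) = (\<Sum>i=r..<min m n. (singular_value (Suc i) A)\<^sup>2)"
    by (rule sum.reindex_bij_witness[of _ Suc "\<lambda>i. i - 1"]) auto
  also have "\<dots> = (\<Sum>i=r..<min m n. d i)" by (simp add: singular_value_sq)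
  also have "\<dots> = (\<Sum>i=r..<n. d i)"
    by (rule sum.mono_neutral_left) (auto simp: eigenvalue_eq_0')
  finally show ?thesis .
qed

text \<open>Here \<open>r\<close> may exceed both dimensions: singular values past
  \<open>min m n\<close> are 0 by convention, eigenvalues from index \<open>m\<close> on are 0 by
  the rank bound.\<close>

lemma sum_singular_value_head:
  "(\<Sum>i=1..r. (singular_value i A)\<^sup>2) = (\<Sum>i<min r n. d i)"
proof -
  have "(\<Sum>i=1..r. (singular_value i A)\<^sup>2) = (\<Sum>i\<in>{1..min r (min m n)}. (singular_value i A)\<^sup>2)"
    by (rule sum.mono_neutral_right) (use A in \<open>auto simp: singular_value_def\<close>)
  also have "\<dots> = (\<Sum>i<min r (min m n). (singular_value (Suc i) A)\<^sup>2)"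
    by (rule sum.reindex_bij_witness[of _ Suc "\<lambda>i. i - 1"]) auto
  also have "\<dots> = (\<Sum>i<min r (min m n). d i)" by (simp add: singular_value_sq)
  also have "\<dots> = (\<Sum>i<min r n. d i)"
    by (rule sum.mono_neutral_left) (auto simp: eigenvalue_eq_0')
  finally show ?thesis .
qed

text \<open>\<open>X\<close> is \<open>A\<close> composed with the orthogonal projection onto the
  first eigenvectors, so \<open>A - X\<close> kills those and agrees with \<open>A\<close> on the
  others.\<close>

lemma best_approximation:
  obtains X where "X \<in> carrier_mat m n" "mat_rank X \<le> r"
    "(frobenius_norm (A - X))\<^sup>2 = (\<Sum>i=r..<n. d i)"
proof -
  \<comment> \<open>Only \<open>n\<close> eigenvectors are available when \<open>r\<close> exceeds
    \<open>n\<close>.\<close>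
  define k where "k = min r n"
  have on: "orthonormal n k u" using orthonormal by (auto simp: orthonormal_def k_def)
  define Q where "Q = mat_of_cols n (map u [0..<k])"
  note Q = orthonormal_mat[OF on, folded Q_def]
  define X where "X = A * Q * Q\<^sup>T"
  have AQ: "A * Q \<in> carrier_mat m k" using A Q(1) by simp
  have X: "X \<in> carrier_mat m n" using A Q(1) by (simp add: X_def)
  have "mat_rank X \<le> r"
    using mat_rank_mult_le[OF AQ, of "Q\<^sup>T" n] Q(1) by (simp add: X_def k_def)
  moreover have Xu: "X *\<^sub>v u j = (if j < r then A *\<^sub>v u j else 0\<^sub>v m)" if j: "j < n" for j
  proof -
    have QT: "Q\<^sup>T *\<^sub>v u j = (if j < k then unit_vec k j else 0\<^sub>v k)"
      using Q(1) Q(4)[OF _ u_carrier[OF j]] orthonormal_scalar_prod[OF orthonormal _ j]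
      by (intro eq_vecI) (auto simp: k_def)
    have "X *\<^sub>v u j = (A * Q) *\<^sub>v (Q\<^sup>T *\<^sub>v u j)"
      unfolding X_def using AQ Q(1) u_carrier[OF j] by (intro assoc_mult_mat_vec) auto
    also have "\<dots> = (if j < r then A *\<^sub>v u j else 0\<^sub>v m)"
    proof (cases "j < r")
      case True
      hence jk: "j < k" using j by (simp add: k_def)
      have "(A * Q) *\<^sub>v unit_vec k j = col (A * Q) j"
        using AQ jk by (intro eq_vecI) auto
      also have "\<dots> = A *\<^sub>v u j" using col_mult2[OF A Q(1) jk] Q(3)[OF jk] by simp
      finally show ?thesis using jk True by (simp only: QT if_True)
    next
      case False
      have "H *\<^sub>v 0\<^sub>v k = 0\<^sub>v m" if "H \<in> carrier_mat m k" for H :: "real mat"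
        using that by (intro eq_vecI) auto
      note this[OF AQ]
      thus ?thesis using False by (simp add: QT k_def)
    qed
    finally show ?thesis .
  qed
  moreover have "(frobenius_norm (A - X))\<^sup>2 = (\<Sum>i=r..<n. d i)"
  proof -
    have AX: "A - X \<in> carrier_mat m n" using X by (rule minus_carrier_mat)
    have "(frobenius_norm (A - X))\<^sup>2 = (\<Sum>j<n. if r \<le> j then d j else 0)"
      unfolding frobenius_norm_sq_orthonormal[OF AX orthonormal]
    proof (intro sum.cong refl)
      fix j assume "j \<in> {..<n}"
      hence j: "j < n" by simp
      have "(A - X) *\<^sub>v u j = A *\<^sub>v u j - X *\<^sub>v u j"
        using A X u_carrier[OF j] by (rule minus_mult_distrib_mat_vec)
      also have "\<dots> = (if r \<le> j then A *\<^sub>v u j else 0\<^sub>v m)"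
        using image_carrier[OF u_carrier[OF j]] by (simp add: Xu[OF j])
      finally show "((A - X) *\<^sub>v u j) \<bullet> ((A - X) *\<^sub>v u j) = (if r \<le> j then d j else 0)"
        using image_norm[OF j] by simp
    qed
    also have "\<dots> = (\<Sum>i\<in>{..<n} \<inter> {j. r \<le> j}. d i)" by (simp add: sum.If_cases)
    also have "{..<n} \<inter> {j. r \<le> j} = {r..<n}" by auto
    finally show ?thesis .
  qed
  ultimately show ?thesis using X that by blast
qed

text \<open>An eigenbasis \<open>v\<close> of \<open>X\<^sup>T X\<close> supplies orthonormal kernel vectors \<open>v j\<close>, \<open>r \<le> j < n\<close>, of \<open>X\<close>;
  on these \<open>A - X\<close> acts as \<open>A\<close>.\<close>

lemma approximation_lower_bound:
  assumes X: "X \<in> carrier_mat m n" and rank: "mat_rank X \<le> r"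
  shows "(\<Sum>i=r..<n. d i) \<le> (frobenius_norm (A - X))\<^sup>2"
\<comment> \<open>For \<open>r \<ge> n\<close> the sum on the left is empty.\<close>
proof (cases "r < n")
  case True
  obtain v e where "gram_eigenbasis X m n v e" using gram_eigenbasis_exists[OF X] .
  then interpret X: gram_eigenbasis X m n v e .
  have AX: "A - X \<in> carrier_mat m n" using X by (rule minus_carrier_mat)
  have kernel: "X *\<^sub>v v j = 0\<^sub>v m" if "r \<le> j" "j < n" for j
    using X.image_norm[of j] X.eigenvalue_eq_0[of j] that rank
      scalar_prod_self_eq_0_iff[OF X.image_carrier[OF X.u_carrier]] by simp
  define w where "w i = (\<Sum>j=r..<n. (u i \<bullet> v j)\<^sup>2)" for i
  \<comment> \<open>The numbers \<open>(u i \<bullet> v j)\<^sup>2\<close> form a doubly stochastic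
    matrix: its row sums bound the weights \<open>w i\<close> by 1, and its column sums give the
    total mass \<open>n - r\<close>.\<close>
  have uv: "(\<Sum>j<n. (u i \<bullet> v j)\<^sup>2) = 1" if "i < n" for i
    using parseval[OF X.orthonormal u_carrier[OF that] u_carrier[OF that]]
      orthonormal_scalar_prod[OF orthonormal that that] comm_scalar_prod[OF u_carrier[OF that] X.u_carrier]
    by (simp add: power2_eq_square)
  have vu: "(\<Sum>i<n. (u i \<bullet> v j)\<^sup>2) = 1" if "j < n" for j
    using parseval[OF orthonormal X.u_carrier[OF that] X.u_carrier[OF that]]
      orthonormal_scalar_prod[OF X.orthonormal that that]
    by (simp add: power2_eq_square)
  have "(\<Sum>i=r..<n. d i) \<le> (\<Sum>i<n. d i * w i)"
  proof (rule sum_tail_le_weighted_sum[OF decreasing _ _ True])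
    fix i assume i: "i < n"
    have "w i \<le> (\<Sum>j<n. (u i \<bullet> v j)\<^sup>2)" unfolding w_def by (rule sum_mono2) auto
    thus "0 \<le> w i \<and> w i \<le> 1" using uv[OF i] by (simp add: w_def sum_nonneg)
  next
    have "(\<Sum>i<n. w i) = (\<Sum>j=r..<n. \<Sum>i<n. (u i \<bullet> v j)\<^sup>2)"
      unfolding w_def by (rule sum.swap)
    thus "(\<Sum>i<n. w i) = real (n - r)" by (simp add: vu)
  qed auto
  also have "\<dots> = (\<Sum>j=r..<n. \<Sum>i<n. d i * (u i \<bullet> v j)\<^sup>2)"
    unfolding w_def sum_distrib_left by (rule sum.swap)
  also have "\<dots> = (\<Sum>j=r..<n. ((A - X) *\<^sub>v v j) \<bullet> ((A - X) *\<^sub>v v j))"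
  proof (intro sum.cong refl)
    fix j assume "j \<in> {r..<n}"
    hence j: "r \<le> j" "j < n" by auto
    have "(A - X) *\<^sub>v v j = A *\<^sub>v v j - X *\<^sub>v v j"
      using A X X.u_carrier[OF j(2)] by (rule minus_mult_distrib_mat_vec)
    hence "(A - X) *\<^sub>v v j = A *\<^sub>v v j"
      using kernel[OF j] image_carrier[OF X.u_carrier[OF j(2)]] by simp
    thus "(\<Sum>i<n. d i * (u i \<bullet> v j)\<^sup>2) = ((A - X) *\<^sub>v v j) \<bullet> ((A - X) *\<^sub>v v j)"
      using image_norm_sum[OF X.u_carrier[OF j(2)]] by simp
  qed
  \<comment> \<open>The basis vectors with \<open>j < r\<close> contribute only nonnegative
    terms.\<close>
  also have "\<dots> \<le> (\<Sum>j<n. ((A - X) *\<^sub>v v j) \<bullet> ((A - X) *\<^sub>v v j))"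
    by (rule sum_mono2) (auto simp: scalar_prod_self_ge_0)
  also have "\<dots> = (frobenius_norm (A - X))\<^sup>2"
    by (rule frobenius_norm_sq_orthonormal[OF AX X.orthonormal, symmetric])
  finally show ?thesis .
qed simp

text \<open>The tail sum is attained by the projected matrix and is a lower bound for every
  competitor, so the infimum is a minimum.\<close>

theorem eckart_young:
  "opt_rank_error_sq r A \<in> rank_approx_sq_errors r A"
  "opt_rank_error_sq r A = (\<Sum>i=r..<n. d i)"
proof -
  have mem: "(\<Sum>i=r..<n. d i) \<in> rank_approx_sq_errors r A"
  proof -
    obtain X where X: "X \<in> carrier_mat m n" "mat_rank X \<le> r"
      and err: "(frobenius_norm (A - X))\<^sup>2 = (\<Sum>i=r..<n. d i)"
      by (rule best_approximation)
    show ?thesis unfolding rank_approx_sq_errors_def err[symmetric] using X A by blast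
  qed
  moreover have "(\<Sum>i=r..<n. d i) \<le> x" if "x \<in> rank_approx_sq_errors r A" for x
    using that A approximation_lower_bound by (auto simp: rank_approx_sq_errors_def)
  ultimately show eq: "opt_rank_error_sq r A = (\<Sum>i=r..<n. d i)"
    unfolding opt_rank_error_sq_def by (rule cInf_eq_minimum)
  show "opt_rank_error_sq r A \<in> rank_approx_sq_errors r A" using mem eq by simp
qed

end

section \<open>Horizontal concatenation\<close>

text \<open>Phrased with lists of columns so that it applies both to a single block and to the whole
  concatenation.\<close>

lemma frobenius_norm_sq_mat_of_cols_diff:
  assumes len: "length cs = length ds" and c: "set cs \<subseteq> carrier_vec m" "set ds \<subseteq> carrier_vec m"
  shows "(frobenius_norm (mat_of_cols m cs - mat_of_cols m ds))\<^sup>2 =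
    (\<Sum>(c, d)\<leftarrow>zip cs ds. (c - d) \<bullet> (c - d))"
proof -
  let ?D = "mat_of_cols m cs - mat_of_cols m ds"
  have D: "?D \<in> carrier_mat m (length cs)" using len by (auto intro!: minus_carrier_mat)
  have v: "cs ! j \<in> carrier_vec m" "ds ! j \<in> carrier_vec m" if "j < length cs" for j
    using that c len by (auto simp: subset_iff)
  have "(frobenius_norm ?D)\<^sup>2 = (\<Sum>j<length cs. \<Sum>i<m. (?D $$ (i, j))\<^sup>2)"
    unfolding frobenius_norm_sq[OF D] by (rule sum.swap)
  also have "\<dots> = (\<Sum>j<length cs. (cs ! j - ds ! j) \<bullet> (cs ! j - ds ! j))"
  proof (intro sum.cong refl)
    fix j assume "j \<in> {..<length cs}"
    hence j: "j < length cs" by simp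
    have "cs ! j - ds ! j \<in> carrier_vec m" using v[OF j] by simp
    thus "(\<Sum>i<m. (?D $$ (i, j))\<^sup>2) = (cs ! j - ds ! j) \<bullet> (cs ! j - ds ! j)"
      using j v[OF j] len by (simp add: scalar_prod_self_sum[of _ m] mat_of_cols_index)
  qed
  also have "\<dots> = (\<Sum>(c, d)\<leftarrow>zip cs ds. (c - d) \<bullet> (c - d))"
    using len by (simp add: sum_list_sum_nth atLeast0LessThan)
  finally show ?thesis .
qed

lemma hconcat_cols_carrier:
  assumes "\<And>j. j \<in> {1..K} \<Longrightarrow> A j \<in> carrier_mat m (n j)"
  shows "set (concat (map (\<lambda>j. cols (A j)) [1..<Suc K])) \<subseteq> carrier_vec m"
proof
  fix x assume "x \<in> set (concat (map (\<lambda>j. cols (A j)) [1..<Suc K]))"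
  then obtain j where "j \<in> {1..K}" "x \<in> set (cols (A j))" by (auto simp del: upt_Suc simp: less_Suc_eq_le)
  thus "x \<in> carrier_vec m" using assms[of j] cols_dim[of "A j"] by auto
qed

lemma hconcat_carrier:
  assumes "\<And>j. j \<in> {1..K} \<Longrightarrow> A j \<in> carrier_mat m (n j)"
  shows "hconcat m K A \<in> carrier_mat m (\<Sum>j=1..K. n j)"
proof -
  have "length (concat (map (\<lambda>j. cols (A j)) [1..<Suc K])) = (\<Sum>j=1..K. n j)"
    using assms by (induction K) auto
  thus ?thesis unfolding hconcat_def by (metis mat_of_cols_carrier(1))
qed

lemma frobenius_norm_sq_hconcat_diff:
  assumes A: "\<And>j. j \<in> {1..K} \<Longrightarrow> A j \<in> carrier_mat m (n j)"
    and B: "\<And>j. j \<in> {1..K} \<Longrightarrow> B j \<in> carrier_mat m (n j)"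
  shows "(frobenius_norm (hconcat m K A - hconcat m K B))\<^sup>2 =
    (\<Sum>j=1..K. (frobenius_norm (A j - B j))\<^sup>2)"
proof -
  \<comment> \<open>On column lists, adding a block is an append. The equality of lengths is carried
    through the induction because it lets \<open>zip\<close> split over the append.\<close>
  define c where "c A K = concat (map (\<lambda>j. cols (A j)) [1..<Suc K])" for A :: "nat \<Rightarrow> real mat" and K
  have "length (c A K) = length (c B K) \<and>
    (\<Sum>(x, y)\<leftarrow>zip (c A K) (c B K). (x - y) \<bullet> (x - y)) = (\<Sum>j=1..K. (frobenius_norm (A j - B j))\<^sup>2)"
    using A B
  proof (induction K)
    case 0
    show ?case by (simp add: c_def)
  next
    case (Suc K)
    let ?A = "A (Suc K)" and ?B = "B (Suc K)"
    have AB: "?A \<in> carrier_mat m (n (Suc K))" "?B \<in> carrier_mat m (n (Suc K))"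
      using Suc.prems by auto
    have "(frobenius_norm (mat_of_cols m (cols ?A) - mat_of_cols m (cols ?B)))\<^sup>2 =
        (\<Sum>(x, y)\<leftarrow>zip (cols ?A) (cols ?B). (x - y) \<bullet> (x - y))"
      using AB cols_dim[of ?A] cols_dim[of ?B]
      by (intro frobenius_norm_sq_mat_of_cols_diff) auto
    moreover have "mat_of_cols m (cols ?A) = ?A" "mat_of_cols m (cols ?B) = ?B"
      using AB mat_of_cols_cols by auto
    moreover have "c X (Suc K) = c X K @ cols (X (Suc K))" for X by (simp add: c_def)
    moreover have "dim_col ?A = dim_col ?B" using AB by (metis carrier_matD(2))
    ultimately show ?case using Suc.IH Suc.prems by simp
  qed
  thus ?thesis unfolding hconcat_def
    using frobenius_norm_sq_mat_of_cols_diff[of "c A K" "c B K" m]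
      hconcat_cols_carrier[of K A, OF A] hconcat_cols_carrier[of K B, OF B]
    by (simp add: c_def)
qed

text \<open>The other blocks contribute only zero columns, so all columns stay in the span of those
  of \<open>X\<close>.\<close>

lemma mat_rank_hconcat_single:
  assumes j: "j \<in> {1..K}" and X: "X \<in> carrier_mat m (n j)"
  shows "mat_rank (hconcat m K (\<lambda>k. if k = j then X else 0\<^sub>m m (n k))) \<le> mat_rank X"
proof -
  interpret vec_space "TYPE(real)" m .
  let ?B = "\<lambda>k. if k = j then X else 0\<^sub>m m (n k)"
  have B: "\<And>k. k \<in> {1..K} \<Longrightarrow> ?B k \<in> carrier_mat m (n k)" using X by simp
  have XS: "set (cols X) \<subseteq> carrier_vec m" using X cols_dim[of X] by auto
  have "X *\<^sub>v 0\<^sub>v (n j) = 0\<^sub>v m" using X by (intro eq_vecI) auto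
  hence zero: "0\<^sub>v m \<in> span (set (cols X))"
    using mult_mat_vec_in_span_cols[OF X, of "0\<^sub>v (n j)"] by simp
  have "set (cols (?B k)) \<subseteq> span (set (cols X))" for k
    using zero in_own_span[of "set (cols X)"] XS by (auto simp: cols_def)
  moreover have "cols (hconcat m K ?B) = concat (map (\<lambda>k. cols (?B k)) [1..<Suc K])"
    unfolding hconcat_def by (rule cols_mat_of_cols, rule hconcat_cols_carrier, rule B)
  ultimately have "set (cols (hconcat m K ?B)) \<subseteq> span (set (cols X))" by auto
  hence "rank (hconcat m K ?B) \<le> rank X"
    unfolding rank_def[of X] using hconcat_carrier[of K ?B, OF B] XS
    by (intro rank_le_dim_span) auto
  thus ?thesis using X by (simp add: mat_rank_def hconcat_def)
qed

text \<open>Stated with the eigenvalues of block \<open>j\<close>, so that both bounds of the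
  theorem follow by rewriting the head sum.\<close>

lemma opt_rank_error_sq_hconcat_le:
  assumes A: "\<And>j. j \<in> {1..K} \<Longrightarrow> A j \<in> carrier_mat m (n j)" and j: "j \<in> {1..K}"
    and d: "gram_eigenbasis (A j) m (n j) u d"
  shows "opt_rank_error_sq r (hconcat m K A) \<le>
    (\<Sum>k=1..K. (frobenius_norm (A k))\<^sup>2) - (\<Sum>i<min r (n j). d i)"
proof -
  interpret Aj: gram_eigenbasis "A j" m "n j" u d by (fact d)
  note M = hconcat_carrier[of K A, OF A]
  obtain X where X: "X \<in> carrier_mat m (n j)" "mat_rank X \<le> r"
    and err: "(frobenius_norm (A j - X))\<^sup>2 = (\<Sum>i=r..<n j. d i)"
    by (rule Aj.best_approximation)
  define B where "B = (\<lambda>k. if k = j then X else 0\<^sub>m m (n k))"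
  have B: "B k \<in> carrier_mat m (n k)" for k using X by (simp add: B_def)
  have rank: "mat_rank (hconcat m K B) \<le> r"
    using mat_rank_hconcat_single[where n = n, OF j X(1)] X(2) by (simp add: B_def)
  obtain v e where "gram_eigenbasis (hconcat m K A) m (\<Sum>j=1..K. n j) v e"
    using gram_eigenbasis_exists[OF M] .
  then interpret M: gram_eigenbasis "hconcat m K A" m "\<Sum>j=1..K. n j" v e .
  \<comment> \<open>The lower bound on all competitors for the concatenation, read as an upper bound
    on the optimum by the error of one competitor.\<close>
  have "opt_rank_error_sq r (hconcat m K A) \<le> (frobenius_norm (hconcat m K A - hconcat m K B))\<^sup>2"
    unfolding M.eckart_young(2) using hconcat_carrier[of K B, OF B] rank
    by (rule M.approximation_lower_bound)
  also have "\<dots> = (\<Sum>k=1..K. (frobenius_norm (A k - B k))\<^sup>2)"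
    by (rule frobenius_norm_sq_hconcat_diff[of K A, OF A B])
  also have "\<dots> = (frobenius_norm (A j - X))\<^sup>2 + (\<Sum>k\<in>{1..K} - {j}. (frobenius_norm (A k - B k))\<^sup>2)"
    by (subst sum.remove[OF finite_atLeastAtMost j]) (simp add: B_def)
  also have "(\<Sum>k\<in>{1..K} - {j}. (frobenius_norm (A k - B k))\<^sup>2) = (\<Sum>k\<in>{1..K} - {j}. (frobenius_norm (A k))\<^sup>2)"
  proof (intro sum.cong refl)
    fix k assume k: "k \<in> {1..K} - {j}"
    hence "A k - B k = A k" using A[of k] by (intro eq_matI) (auto simp: B_def)
    thus "(frobenius_norm (A k - B k))\<^sup>2 = (frobenius_norm (A k))\<^sup>2" by simp
  qed
  finally have le: "opt_rank_error_sq r (hconcat m K A) \<le>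
    (\<Sum>i=r..<n j. d i) + (\<Sum>k\<in>{1..K} - {j}. (frobenius_norm (A k))\<^sup>2)" unfolding err .
  have total: "(\<Sum>k=1..K. (frobenius_norm (A k))\<^sup>2) =
    (\<Sum>i<n j. d i) + (\<Sum>k\<in>{1..K} - {j}. (frobenius_norm (A k))\<^sup>2)"
    unfolding Aj.frobenius_norm_sq_eq[symmetric] by (rule sum.remove[OF finite_atLeastAtMost j])
  \<comment> \<open>The \<open>min\<close> keeps this a partition when \<open>r\<close> exceeds
    \<open>n j\<close>.\<close>
  have "{..<n j} = {..<min r (n j)} \<union> {r..<n j}" by auto
  hence "(\<Sum>i<n j. d i) = sum d ({..<min r (n j)} \<union> {r..<n j})" by (rule arg_cong)
  also have "\<dots> = (\<Sum>i<min r (n j). d i) + (\<Sum>i=r..<n j. d i)"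
    by (rule sum.union_disjoint) auto
  finally show ?thesis using le total by linarith
qed

section \<open>Error bounds for the concatenated matrix\<close>

theorem theorem1:
  fixes K m :: nat and n :: "nat \<Rightarrow> nat" and A :: "nat \<Rightarrow> real mat" and M :: "real mat"
  assumes K: "K \<ge> 1"
    and A: "\<And>j. j \<in> {1..K} \<Longrightarrow> A j \<in> carrier_mat m (n j)"
    and M: "M = hconcat m K A"
  shows "(\<forall>r::nat.
            opt_rank_error_sq r M \<in> rank_approx_sq_errors r M \<and>
            opt_rank_error_sq r M =
              (\<Sum>i\<in>{r<..min (dim_row M) (dim_col M)}. (singular_value i M)\<^sup>2)) \<and>
         (\<forall>r\<ge>1.
            opt_rank_error_sq r M \<le>
              (\<Sum>j=1..K. (frobenius_norm (A j))\<^sup>2) -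
              Max ((\<lambda>j. \<Sum>i=1..r. (singular_value i (A j))\<^sup>2) ` {1..K})) \<and>
         (\<forall>r\<ge>1. r \<ge> Max ((\<lambda>j. mat_rank (A j)) ` {1..K}) \<longrightarrow>
            opt_rank_error_sq r M \<le>
              (\<Sum>j=1..K. (frobenius_norm (A j))\<^sup>2) -
              Max ((\<lambda>j. (frobenius_norm (A j))\<^sup>2) ` {1..K}))"
proof (intro conjI allI impI)
  have Mc: "M \<in> carrier_mat m (\<Sum>j=1..K. n j)" unfolding M by (rule hconcat_carrier[OF A])
  obtain v e where "gram_eigenbasis M m (\<Sum>j=1..K. n j) v e"
    using gram_eigenbasis_exists[OF Mc] .
  then interpret M: gram_eigenbasis M m "\<Sum>j=1..K. n j" v e .
  fix r
  show "opt_rank_error_sq r M \<in> rank_approx_sq_errors r M" by (rule M.eckart_young)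
  have "dim_row M = m" "dim_col M = (\<Sum>j=1..K. n j)" using Mc by auto
  thus "opt_rank_error_sq r M =
      (\<Sum>i\<in>{r<..min (dim_row M) (dim_col M)}. (singular_value i M)\<^sup>2)"
    by (simp only: M.eckart_young(2) M.sum_singular_value_tail)
  have ne: "{1..K} \<noteq> {}" using K by simp
  \<comment> \<open>Each maximum is attained at some block, so the bound for that single block
    suffices.\<close>
  have in_image: "Max (f ` {1..K}) \<in> f ` {1..K}" for f :: "nat \<Rightarrow> real"
    using ne by (intro Max_in) auto
  obtain j where j: "j \<in> {1..K}"
    and max: "Max ((\<lambda>j. \<Sum>i=1..r. (singular_value i (A j))\<^sup>2) ` {1..K}) = (\<Sum>i=1..r. (singular_value i (A j))\<^sup>2)"
    using in_image by blast
  obtain u d where d: "gram_eigenbasis (A j) m (n j) u d"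
    using gram_eigenbasis_exists[OF A[OF j]] .
  show "opt_rank_error_sq r M \<le> (\<Sum>j=1..K. (frobenius_norm (A j))\<^sup>2) -
      Max ((\<lambda>j. \<Sum>i=1..r. (singular_value i (A j))\<^sup>2) ` {1..K})"
    unfolding max gram_eigenbasis.sum_singular_value_head[OF d] M
    by (rule opt_rank_error_sq_hconcat_le[where A = A and n = n, OF A j d])
  assume rank: "r \<ge> Max ((\<lambda>j. mat_rank (A j)) ` {1..K})"
  obtain l where l: "l \<in> {1..K}"
    and max': "Max ((\<lambda>j. (frobenius_norm (A j))\<^sup>2) ` {1..K}) = (frobenius_norm (A l))\<^sup>2"
    using in_image by blast
  have "mat_rank (A l) \<le> Max ((\<lambda>j. mat_rank (A j)) ` {1..K})" using l by (intro Max_ge) auto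
  hence rl: "mat_rank (A l) \<le> r" using rank by simp
  obtain u' d' where d': "gram_eigenbasis (A l) m (n l) u' d'"
    using gram_eigenbasis_exists[OF A[OF l]] .
  \<comment> \<open>Eigenvalues beyond the rank vanish, so for rank at most \<open>r\<close> the
    head sum is already the full squared norm.\<close>
  have "(\<Sum>i<n l. d' i) = (\<Sum>i<min r (n l). d' i)"
    using gram_eigenbasis.eigenvalue_eq_0[OF d'] rl by (intro sum.mono_neutral_right) auto
  thus "opt_rank_error_sq r M \<le> (\<Sum>j=1..K. (frobenius_norm (A j))\<^sup>2) -
      Max ((\<lambda>j. (frobenius_norm (A j))\<^sup>2) ` {1..K})"
    unfolding max' gram_eigenbasis.frobenius_norm_sq_eq[OF d'] M
    using opt_rank_error_sq_hconcat_le[where A = A and n = n, OF A l d'] by simp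
qed

end
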